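(* Let $X$ be an $L$-algebra. The lattice $\mathcal{I}(X)$ of ideals of $X$ is a spatial locale. The $L$-algebra operation of $\mathcal{I}(X)$ is given, for $I,J\in\mathcal{I}(X)$, by $$I\cdot J=\{x\in X\mid \langle x\rangle\cap I\subseteq J\},$$ where $\langle x\rangle$ denotes the ideal of $X$ generated by $x$.
   Context: An $L$-algebra is a set $X$ with a binary operation $(x,y)\mapsto x\cdot y$ and an element $1\in X$ such that for all $x,y,z\in X$: (i) $x\cdot x=x\cdot 1=1$ and $1\cdot x=x$; (ii) $(x\cdot y)\cdot(x\cdot z)=(y\cdot x)\cdot(y\cdot z)$; (iii) $x\cdot y=y\cdot x=1$ implies $x=y$. It is partially ordered by $x\le y:\Leftrightarrow x\cdot y=1$, with greatest element $1$. An ideal of $X$ is a subset $I\subseteq X$ with $1\in I$ such that for all $x,y\in X$: if $x\in I$ and $x\cdot y\in I$, then $y\in I$; if $x\in I$, then $(x\cdot y)\cdot y\in I$; if $x\in I$, then $y\cdot x\in I$ and $y\cdot(x\cdot y)\in I$. $\mathcal{I}(X)$ is the set of ideals of $X$ ordered by inclusion; it is a complete lattice whose meets are intersections. A locale is a complete lattice $A$ with $a\wedge\bigvee_{i}a_i=\bigvee_{i}(a\wedge a_i)$ for all $a\in A$ and all families $(a_i)$ in $A$. A locale is an $L$-algebra with operation $a\cdot b:=\bigvee\{c\in A\mid c\wedge a\le b\}$ (and the $L$-algebra order is the lattice order). An element $p<1$ of an $L$-algebra $Y$ is prime if for every $x\in Y$ either $x\le p$ or $x\cdot p\le p$; $P(Y)$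 is the set of prime elements. $Y$ is spatial if $x=\bigwedge\{p\in P(Y)\mid x\le p\}$ for all $x\in Y$. A locale is spatial if it is spatial as an $L$-algebra. *)

theory Defs
  imports "HOL-Algebra.Complete_Lattice"
begin

locale L_algebra =
  fixes X :: "'a set" and dot :: "'a \<Rightarrow> 'a \<Rightarrow> 'a" (infixl "\<cdot>" 70) and unit :: 'a ("\<e>")
  assumes dot_closed: "\<lbrakk>x \<in> X; y \<in> X\<rbrakk> \<Longrightarrow> x \<cdot> y \<in> X"
    and unit_closed: "\<e> \<in> X"
    and dot_self: "x \<in> X \<Longrightarrow> x \<cdot> x = \<e>"
    and dot_unit: "x \<in> X \<Longrightarrow> x \<cdot> \<e> = \<e>"
    and unit_dot: "x \<in> X \<Longrightarrow> \<e> \<cdot> x = x"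
    and cycloid: "\<lbrakk>x \<in> X; y \<in> X; z \<in> X\<rbrakk> \<Longrightarrow> (x \<cdot> y) \<cdot> (x \<cdot> z) = (y \<cdot> x) \<cdot> (y \<cdot> z)"
    and dot_antisym: "\<lbrakk>x \<in> X; y \<in> X; x \<cdot> y = \<e>; y \<cdot> x = \<e>\<rbrakk> \<Longrightarrow> x = y"

definition L_order :: "'a set \<Rightarrow> ('a \<Rightarrow> 'a \<Rightarrow> 'a) \<Rightarrow> 'a \<Rightarrow> 'a gorder" where
  "L_order X dot unit = \<lparr>carrier = X, eq = (=), le = (\<lambda>x y. dot x y = unit)\<rparr>"

definition L_ideal :: "'a set \<Rightarrow> ('a \<Rightarrow> 'a \<Rightarrow> 'a) \<Rightarrow> 'a \<Rightarrow> 'a set \<Rightarrow> bool" where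
  "L_ideal X dot unit I \<longleftrightarrow> I \<subseteq> X \<and> unit \<in> I \<and>
     (\<forall>x\<in>X. \<forall>y\<in>X.
        (x \<in> I \<and> dot x y \<in> I \<longrightarrow> y \<in> I) \<and>
        (x \<in> I \<longrightarrow> dot (dot x y) y \<in> I) \<and>
        (x \<in> I \<longrightarrow> dot y x \<in> I \<and> dot y (dot x y) \<in> I))"

definition L_ideals :: "'a set \<Rightarrow> ('a \<Rightarrow> 'a \<Rightarrow> 'a) \<Rightarrow> 'a \<Rightarrow> 'a set gorder" where
  "L_ideals X dot unit = \<lparr>carrier = {I. L_ideal X dot unit I}, eq = (=), le = (\<subseteq>)\<rparr>"

definition L_genideal :: "'a set \<Rightarrow> ('a \<Rightarrow> 'a \<Rightarrow> 'a) \<Rightarrow> 'a \<Rightarrow> 'a \<Rightarrow> 'a set" where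
  "L_genideal X dot unit x = \<Inter>{I. L_ideal X dot unit I \<and> x \<in> I}"

definition L_primes :: "'a set \<Rightarrow> ('a \<Rightarrow> 'a \<Rightarrow> 'a) \<Rightarrow> 'a \<Rightarrow> 'a set" where
  "L_primes Y dot unit =
     {p \<in> Y. p \<sqsubset>\<^bsub>L_order Y dot unit\<^esub> unit \<and>
        (\<forall>x\<in>Y. x \<sqsubseteq>\<^bsub>L_order Y dot unit\<^esub> p \<or> dot x p \<sqsubseteq>\<^bsub>L_order Y dot unit\<^esub> p)}"

text \<open>The infimum in the definition of spatiality is expressed by \<^const>\<open>is_glb\<close>, as a general
  $L$-algebra need not be a complete lattice. The infimum of the empty set is the unit.\<close>

locale spatial_L_algebra = L_algebra Y dot unit
  for Y :: "'a set" and dot :: "'a \<Rightarrow> 'a \<Rightarrow> 'a" and unit :: 'a +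
  assumes is_glb_primes: "x \<in> Y \<Longrightarrow>
    is_glb (L_order Y dot unit) x {p \<in> L_primes Y dot unit. x \<sqsubseteq>\<^bsub>L_order Y dot unit\<^esub> p}"

text \<open>Locales in the sense of point-free topology (frames). Families are represented by the sets of
  their members.\<close>

locale frame_lattice = complete_lattice A for A :: "('a, 'b) gorder_scheme" (structure) +
  assumes meet_Sup_distrib: "\<lbrakk>a \<in> carrier A; B \<subseteq> carrier A\<rbrakk> \<Longrightarrow>
    a \<sqinter> (\<Squnion>B) = \<Squnion>((\<lambda>b. a \<sqinter> b) ` B)"

definition frame_imp :: "('a, 'b) gorder_scheme \<Rightarrow> 'a \<Rightarrow> 'a \<Rightarrow> 'a" where
  "frame_imp A a b = \<Squnion>\<^bsub>A\<^esub>{c \<in> carrier A. c \<sqinter>\<^bsub>A\<^esub> a \<sqsubseteq>\<^bsub>A\<^esub> b}"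

definition spatial_frame :: "('a, 'b) gorder_scheme \<Rightarrow> bool" where
  "spatial_frame A \<longleftrightarrow> frame_lattice A \<and>
     spatial_L_algebra (carrier A) (frame_imp A) \<top>\<^bsub>A\<^esub>"

end

theory Submission
  imports Defs
begin

text \<open>The heart of the matter is that the ideal lattice is distributive. Every ideal \<open>B\<close> induces a
  congruence, and \<open>x \<cdot> y\<close> is congruent to \<open>y\<close> as soon as \<open>x \<in> B\<close>. This shows that the join of two ideals
  \<open>A\<close> and \<open>B\<close> is the saturation of \<open>A\<close> under the congruence of \<open>B\<close>. If \<open>z \<in> I\<close> is congruent modulo \<open>B\<close>
  to an element \<open>a \<in> A\<close>, then \<open>a \<cdot> z \<in> B \<inter> I\<close> and \<open>(a \<cdot> z) \<cdot> z \<in> A \<inter> I\<close>, so \<open>z\<close> lies in every ideal that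
  contains \<open>A \<inter> I\<close> and \<open>B \<inter> I\<close>. Consequently \<open>{x. \<langle>x\<rangle> \<inter> I \<subseteq> J}\<close> is an ideal, and it is a relative
  pseudocomplement. For spatiality, an ideal that contains \<open>I\<close> and is maximal among those that omit a
  given \<open>x \<notin> I\<close> is prime.\<close>

section \<open>The implication of a frame\<close>

context frame_lattice
begin

lemma frame_imp_closed [simp]: "frame_imp A a b \<in> carrier A"
  unfolding frame_imp_def by (rule sup_closed) auto

lemma le_frame_imp_iff:
  assumes [simp]: "a \<in> carrier A" "b \<in> carrier A" "c \<in> carrier A"
  shows "c \<sqsubseteq> frame_imp A a b \<longleftrightarrow> c \<sqinter> a \<sqsubseteq> b"
proof
  let ?S = "{c \<in> carrier A. c \<sqinter> a \<sqsubseteq> b}"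
  have S: "?S \<subseteq> carrier A" by auto
  have comm: "x \<sqinter> a = a \<sqinter> x" for x
    by (simp add: meet_def insert_commute)
  \<comment> \<open>Distributivity makes the supremum itself a member of \<open>?S\<close>, so it is
    the greatest one.\<close>
  have "frame_imp A a b \<sqinter> a = \<Squnion>((\<lambda>x. a \<sqinter> x) ` ?S)"
    using meet_Sup_distrib[OF assms(1) S] by (simp add: frame_imp_def comm)
  also have "\<dots> \<sqsubseteq> b"
    by (rule sup_least) (auto simp flip: comm)
  finally have *: "frame_imp A a b \<sqinter> a \<sqsubseteq> b" .
  assume c: "c \<sqsubseteq> frame_imp A a b"
  have "c \<sqinter> a \<sqsubseteq> frame_imp A a b \<sqinter> a"
    by (rule meet_le) (auto intro: le_trans[OF meet_left c] meet_right)
  then show "c \<sqinter> a \<sqsubseteq> b"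
    using * by (rule le_trans) auto
next
  assume "c \<sqinter> a \<sqsubseteq> b"
  then show "c \<sqsubseteq> frame_imp A a b"
    unfolding frame_imp_def by (intro sup_upper) auto
qed

lemma frame_imp_eq_top_iff:
  assumes [simp]: "a \<in> carrier A" "b \<in> carrier A"
  shows "frame_imp A a b = \<top> \<longleftrightarrow> a \<sqsubseteq> b"
proof -
  have "\<top> \<sqinter> a = a"
    by (rule le_antisym) (auto intro: meet_right meet_le)
  moreover have "frame_imp A a b = \<top> \<longleftrightarrow> \<top> \<sqsubseteq> frame_imp A a b"
    by (metis frame_imp_closed le_antisym le_refl top_closed top_higher)
  ultimately show ?thesis
    by (simp add: le_frame_imp_iff)
qed

lemma eq_iff_below:
  assumes "a \<in> carrier A" "b \<in> carrier A"
    and "\<And>c. c \<in> carrier A \<Longrightarrow> c \<sqsubseteq> a \<longleftrightarrow> c \<sqsubseteq> b"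
  shows "a = b"
  using assms by (meson le_antisym le_refl)

text \<open>The right-hand side depends on \<open>a\<close> and \<open>b\<close> only through their
  meet; its symmetry yields the cycloid equation of an L-algebra.\<close>

lemma frame_imp_frame_imp:
  assumes [simp]: "a \<in> carrier A" "b \<in> carrier A" "c \<in> carrier A"
  shows "frame_imp A (frame_imp A a b) (frame_imp A a c) = frame_imp A (a \<sqinter> b) c"
proof (rule eq_iff_below)
  fix d assume [simp]: "d \<in> carrier A"
  \<comment> \<open>Modus ponens in the frame: below \<open>a\<close>, lying under
    \<open>frame_imp A a b\<close> is the same as lying under \<open>b\<close>.\<close>
  have *: "(d \<sqinter> frame_imp A a b) \<sqinter> a = d \<sqinter> (a \<sqinter> b)"
  proof (rule eq_iff_below)
    fix e assume [simp]: "e \<in> carrier A"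
    have le_meet: "e \<sqsubseteq> x \<sqinter> y \<longleftrightarrow> e \<sqsubseteq> x \<and> e \<sqsubseteq> y" if "x \<in> carrier A" "y \<in> carrier A" for x y
      using that \<open>e \<in> carrier A\<close> by (meson le_trans meet_closed meet_le meet_left meet_right)
    have "e \<sqinter> a = e" if "e \<sqsubseteq> a"
      using that by (intro le_antisym) (auto intro: meet_left meet_le)
    then show "e \<sqsubseteq> (d \<sqinter> frame_imp A a b) \<sqinter> a \<longleftrightarrow> e \<sqsubseteq> d \<sqinter> (a \<sqinter> b)"
      by (auto simp: le_meet le_frame_imp_iff)
  qed auto
  show "d \<sqsubseteq> frame_imp A (frame_imp A a b) (frame_imp A a c) \<longleftrightarrow> d \<sqsubseteq> frame_imp A (a \<sqinter> b) c"
    by (simp add: le_frame_imp_iff *)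
qed auto

lemma L_algebra_frame_imp: "L_algebra (carrier A) (frame_imp A) \<top>"
proof
  fix x y z assume [simp]: "x \<in> carrier A" "y \<in> carrier A" "z \<in> carrier A"
  have "x \<sqinter> y = y \<sqinter> x"
    by (simp add: meet_def insert_commute)
  then show "frame_imp A (frame_imp A x y) (frame_imp A x z) =
      frame_imp A (frame_imp A y x) (frame_imp A y z)"
    by (simp add: frame_imp_frame_imp)
next
  fix x assume [simp]: "x \<in> carrier A"
  have "c \<sqinter> \<top> = c" if "c \<in> carrier A" for c
    using that by (intro le_antisym) (auto intro: meet_left meet_le)
  then show "frame_imp A \<top> x = x"
    by (intro eq_iff_below) (auto simp: le_frame_imp_iff)
qed (auto simp: frame_imp_eq_top_iff le_antisym)

end

section \<open>Ideals and congruences\<close>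

context L_algebra
begin

abbreviation ideal :: "'a set \<Rightarrow> bool" where
  "ideal \<equiv> L_ideal X (\<cdot>) \<e>"

abbreviation gen :: "'a \<Rightarrow> 'a set" where
  "gen \<equiv> L_genideal X (\<cdot>) \<e>"

lemma ideal_subset: "ideal I \<Longrightarrow> I \<subseteq> X"
  and ideal_unit: "ideal I \<Longrightarrow> \<e> \<in> I"
  by (auto simp: L_ideal_def)

lemma ideal_mp: "\<lbrakk>ideal I; x \<in> I; x \<cdot> y \<in> I; y \<in> X\<rbrakk> \<Longrightarrow> y \<in> I"
  and ideal_dot_dot: "\<lbrakk>ideal I; x \<in> I; y \<in> X\<rbrakk> \<Longrightarrow> (x \<cdot> y) \<cdot> y \<in> I"
  and ideal_dot: "\<lbrakk>ideal I; x \<in> I; y \<in> X\<rbrakk> \<Longrightarrow> y \<cdot> x \<in> I"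
  and ideal_dot_dot': "\<lbrakk>ideal I; x \<in> I; y \<in> X\<rbrakk> \<Longrightarrow> y \<cdot> (x \<cdot> y) \<in> I"
  unfolding L_ideal_def by blast+

lemma idealI:
  assumes "I \<subseteq> X" "\<e> \<in> I"
    and "\<And>x y. \<lbrakk>x \<in> I; x \<cdot> y \<in> I; y \<in> X\<rbrakk> \<Longrightarrow> y \<in> I"
    and "\<And>x y. \<lbrakk>x \<in> I; y \<in> X\<rbrakk> \<Longrightarrow> (x \<cdot> y) \<cdot> y \<in> I"
    and "\<And>x y. \<lbrakk>x \<in> I; y \<in> X\<rbrakk> \<Longrightarrow> y \<cdot> x \<in> I"
    and "\<And>x y. \<lbrakk>x \<in> I; y \<in> X\<rbrakk> \<Longrightarrow> y \<cdot> (x \<cdot> y) \<in> I"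
  shows "ideal I"
proof -
  have "y \<in> I" if "x \<in> I \<and> x \<cdot> y \<in> I" "y \<in> X" for x y
    using that by (elim conjE) (rule assms(3))
  then show ?thesis
    unfolding L_ideal_def by (intro conjI ballI impI assms(1,2,4-))
qed

lemma ideal_carrier: "ideal X"
  by (simp add: L_ideal_def unit_closed dot_closed)

text \<open>The empty family is excluded because its intersection is the whole type rather than
  \<open>X\<close>.\<close>

lemma ideal_Inter:
  assumes "\<I> \<noteq> {}" and ideal: "\<And>I. I \<in> \<I> \<Longrightarrow> ideal I"
  shows "ideal (\<Inter>\<I>)"
proof (rule idealI)
  show "\<Inter>\<I> \<subseteq> X"
    using assms ideal_subset by blast
qed (auto dest: ideal intro: ideal_unit ideal_mp ideal_dot_dot ideal_dot ideal_dot_dot')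

lemma ideal_Int: "\<lbrakk>ideal I; ideal J\<rbrakk> \<Longrightarrow> ideal (I \<inter> J)"
  using ideal_Inter[of "{I, J}"] by auto

lemma ideal_gen: "x \<in> X \<Longrightarrow> ideal (gen x)"
  unfolding L_genideal_def by (rule ideal_Inter) (use ideal_carrier in auto)

lemma in_gen: "x \<in> gen x"
  by (simp add: L_genideal_def)

lemma gen_subset: "\<lbrakk>ideal I; x \<in> I\<rbrakk> \<Longrightarrow> gen x \<subseteq> I"
  by (auto simp: L_genideal_def)

section \<open>The congruence induced by an ideal\<close>

definition cong :: "'a set \<Rightarrow> 'a \<Rightarrow> 'a \<Rightarrow> bool" where
  "cong I x y \<longleftrightarrow> x \<in> X \<and> y \<in> X \<and> x \<cdot> y \<in> I \<and> y \<cdot> x \<in> I"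

lemma cong_sym: "cong I x y \<Longrightarrow> cong I y x"
  by (simp add: cong_def)

lemma cong_closed: "cong I x y \<Longrightarrow> x \<in> X" "cong I x y \<Longrightarrow> y \<in> X"
  by (simp_all add: cong_def)

lemma cong_mem_iff:
  assumes "ideal I" "cong I x y"
  shows "x \<in> I \<longleftrightarrow> y \<in> I"
  using assms by (auto simp: cong_def intro: ideal_mp)

context
  fixes I
  assumes I: "ideal I"
begin

lemma cong_refl: "x \<in> X \<Longrightarrow> cong I x x"
  by (simp add: cong_def dot_self ideal_unit[OF I])

text \<open>The cycloid equation rewrites (x \<cdot> y) \<cdot> (x \<cdot> z) as (y \<cdot> x)
  \<cdot> (y \<cdot> z), which lies in \<open>I\<close> because y \<cdot> z does; modus ponens for
  \<open>I\<close> then removes x \<cdot> y.\<close>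

lemma dot_in_trans:
  assumes "x \<cdot> y \<in> I" "y \<cdot> z \<in> I" and [simp]: "x \<in> X" "y \<in> X" "z \<in> X"
  shows "x \<cdot> z \<in> I"
proof -
  have "(x \<cdot> y) \<cdot> (x \<cdot> z) \<in> I"
    using ideal_dot[OF I assms(2), of "y \<cdot> x"] by (simp add: cycloid[of x y] dot_closed)
  with I assms(1) show ?thesis
    by (rule ideal_mp) (simp add: dot_closed)
qed

lemma cong_trans: "\<lbrakk>cong I x y; cong I y z\<rbrakk> \<Longrightarrow> cong I x z"
  unfolding cong_def by (meson dot_in_trans)

lemma cong_dot_left:
  assumes "cong I x y" "z \<in> X"
  shows "cong I (z \<cdot> x) (z \<cdot> y)"
  using assms I by (simp add: cong_def dot_closed cycloid[of z] ideal_dot)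

text \<open>The last two kinds of ideal condition, on (b \<cdot> z) \<cdot> z and z \<cdot> (b
  \<cdot> z), say exactly that elements of \<open>I\<close> act from the left like the unit modulo
  \<open>I\<close>.\<close>

lemma cong_ideal_dot:
  assumes "b \<in> I" "z \<in> X"
  shows "cong I (b \<cdot> z) z"
  using assms I ideal_subset[OF I] by (auto simp: cong_def dot_closed ideal_dot_dot ideal_dot_dot')

text \<open>Both x \<cdot> z and y \<cdot> z are congruent to the common value of the two sides of
  the cycloid equation, since x \<cdot> y and y \<cdot> x act trivially modulo
  \<open>I\<close>.\<close>

lemma cong_dot_right:
  assumes "cong I x y" "z \<in> X"
  shows "cong I (x \<cdot> z) (y \<cdot> z)"
proof -
  have [simp]: "x \<in> X" "y \<in> X" "z \<in> X" and xy: "x \<cdot> y \<in> I" "y \<cdot> x \<in> I"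
    using assms by (auto simp: cong_def)
  have "cong I ((x \<cdot> y) \<cdot> (x \<cdot> z)) (x \<cdot> z)" "cong I ((x \<cdot> y) \<cdot> (x \<cdot> z)) (y \<cdot> z)"
    using cong_ideal_dot[OF xy(1), of "x \<cdot> z"] cong_ideal_dot[OF xy(2), of "y \<cdot> z"]
    by (simp_all add: cycloid[of x y] dot_closed)
  then show ?thesis
    by (blast intro: cong_sym cong_trans)
qed

lemma cong_dot: "\<lbrakk>cong I x x'; cong I y y'\<rbrakk> \<Longrightarrow> cong I (x \<cdot> y) (x' \<cdot> y')"
  by (meson cong_dot_left cong_dot_right cong_trans cong_closed)

end

text \<open>Only closure under modus ponens is delicate; the other conditions pass from
  \<open>A\<close> to its saturation because \<open>cong B\<close> respects the operation.\<close>

lemma ideal_saturation: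
  assumes A: "ideal A" and B: "ideal B"
  shows "ideal {z. \<exists>a\<in>A. cong B z a}" (is "ideal ?C")
proof -
  note ABX = subsetD[OF ideal_subset[OF A]]
  have mp: "y \<in> ?C" if z: "z \<in> ?C" and zy: "z \<cdot> y \<in> ?C" and [simp]: "y \<in> X" for y z
  proof -
    obtain a a' where a: "a \<in> A" "cong B z a" and a': "a' \<in> A" "cong B (z \<cdot> y) a'"
      using z zy by blast
    have [simp]: "a \<in> X" "a' \<in> X" using a a' ABX by auto
    \<comment> \<open>Modulo \<open>B\<close> the factors a' and a \<cdot> y agree, so
      \<open>b\<close> lies in \<open>B\<close> and b \<cdot> y is congruent to \<open>y\<close>.
      Modulo \<open>A\<close> both \<open>a\<close> and a' act trivially, so \<open>b\<close> is
      congruent to \<open>y\<close> and b \<cdot> y lies in \<open>A\<close>. Thus b \<cdot> y is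
      the witness for \<open>y\<close>.\<close>
    define b where "b = a' \<cdot> (a \<cdot> y)"
    have "cong B (a \<cdot> y) a'"
      using cong_dot_right[OF B a(2), of y] a'(2) by (blast intro: cong_trans[OF B] cong_sym \<open>y \<in> X\<close>)
    then have "b \<in> B" by (simp add: b_def cong_def)
    then have by_cong: "cong B y (b \<cdot> y)"
      by (rule cong_sym[OF cong_ideal_dot[OF B]]) auto
    have "cong A b y"
      unfolding b_def by (rule cong_trans[OF A cong_ideal_dot[OF A] cong_ideal_dot[OF A]])
        (use a a' in \<open>auto simp: dot_closed\<close>)
    then have "cong A (b \<cdot> y) (y \<cdot> y)"
      by (rule cong_dot_right[OF A]) auto
    then have "b \<cdot> y \<in> A"
      using cong_mem_iff[OF A] ideal_unit[OF A] by (simp add: dot_self)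
    with by_cong show ?thesis by blast
  qed
  have dots: "(z \<cdot> y) \<cdot> y \<in> ?C" "y \<cdot> z \<in> ?C" "y \<cdot> (z \<cdot> y) \<in> ?C"
    if z: "z \<in> ?C" and "y \<in> X" for y z
  proof -
    obtain a where a: "a \<in> A" "cong B z a" using z by blast
    note refl = cong_refl[OF B \<open>y \<in> X\<close>]
    note cong = cong_dot[OF B]
    show "(z \<cdot> y) \<cdot> y \<in> ?C"
      using ideal_dot_dot[OF A a(1) \<open>y \<in> X\<close>] cong[OF cong[OF a(2) refl] refl] by blast
    show "y \<cdot> z \<in> ?C"
      using ideal_dot[OF A a(1) \<open>y \<in> X\<close>] cong[OF refl a(2)] by blast
    show "y \<cdot> (z \<cdot> y) \<in> ?C"
      using ideal_dot_dot'[OF A a(1) \<open>y \<in> X\<close>] cong[OF refl cong[OF a(2) refl]] by blast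
  qed
  have "?C \<subseteq> X" by (auto dest: cong_closed)
  moreover have "\<e> \<in> ?C"
    using ideal_unit[OF A] cong_refl[OF B unit_closed] by blast
  ultimately show ?thesis
    using mp dots by (rule idealI)
qed

text \<open>An elementwise form of distributivity: the saturation of \<open>A\<close> replaces the
  join of \<open>A\<close> and \<open>B\<close>, and \<open>J\<close> is any ideal above both
  meets.\<close>

lemma ideal_distrib:
  assumes A: "ideal A" and B: "ideal B" and I: "ideal I" and J: "ideal J"
    and AJ: "A \<inter> I \<subseteq> J" and BJ: "B \<inter> I \<subseteq> J" and "a \<in> A" "cong B z a" "z \<in> I"
  shows "z \<in> J"
proof -
  have [simp]: "a \<in> X" "z \<in> X" using \<open>cong B z a\<close> by (auto simp: cong_def)
  have "a \<cdot> z \<in> B" using \<open>cong B z a\<close> by (simp add: cong_def)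
  moreover have "a \<cdot> z \<in> I" using I \<open>z \<in> I\<close> by (rule ideal_dot) simp
  ultimately have az: "a \<cdot> z \<in> J" using BJ by auto
  have "(a \<cdot> z) \<cdot> z \<in> A" using A \<open>a \<in> A\<close> by (rule ideal_dot_dot) simp
  moreover have "(a \<cdot> z) \<cdot> z \<in> I" using I \<open>z \<in> I\<close> by (rule ideal_dot) (simp add: dot_closed)
  ultimately have "(a \<cdot> z) \<cdot> z \<in> J" using AJ by auto
  with J az show ?thesis by (rule ideal_mp) simp
qed

section \<open>The relative pseudocomplement\<close>

text \<open>This is the union of all ideals \<open>C\<close> with C \<inter> I \<subseteq> J,
  because for such a \<open>C\<close> every principal ideal inside it has the same property.\<close>

definition residual :: "'a set \<Rightarrow> 'a set \<Rightarrow> 'a set" where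
  "residual I J = {x \<in> X. gen x \<inter> I \<subseteq> J}"

lemma ideal_residual:
  assumes I: "ideal I" and J: "ideal J"
  shows "ideal (residual I J)"
proof -
  \<comment> \<open>All closure conditions with a single premise produce elements of
    \<open>gen x\<close>, so this fact covers them.\<close>
  have smaller: "y \<in> residual I J" if "x \<in> residual I J" "y \<in> gen x" for x y
  proof -
    have "ideal (gen x)"
      using that(1) by (simp add: residual_def ideal_gen)
    then show ?thesis
      using that gen_subset ideal_subset unfolding residual_def by blast
  qed
  have mp: "y \<in> residual I J"
    if x: "x \<in> residual I J" and xy: "x \<cdot> y \<in> residual I J" and [simp]: "y \<in> X" for x y
  proof -
    let ?A = "gen x" and ?B = "gen (x \<cdot> y)"
    let ?C = "{z. \<exists>a\<in>?A. cong ?B z a}"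
    have [simp]: "x \<in> X" using x by (simp add: residual_def)
    have A: "ideal ?A" and B: "ideal ?B" by (simp_all add: ideal_gen dot_closed)
    note C = ideal_saturation[OF A B]
    have "x \<in> ?C" using in_gen[of x] cong_refl[OF B \<open>x \<in> X\<close>] by blast
    \<comment> \<open>The witness in \<open>?A\<close> is the unit, to which x \<cdot> y is
      congruent modulo \<open>?B\<close>.\<close>
    moreover have "x \<cdot> y \<in> ?C"
      using ideal_unit[OF A] in_gen[of "x \<cdot> y"] ideal_unit[OF B]
      by (auto intro!: bexI[of _ "\<e>"] simp: cong_def dot_closed unit_closed dot_unit unit_dot)
    ultimately have "y \<in> ?C" using C ideal_mp \<open>y \<in> X\<close> by blast
    then have "gen y \<subseteq> ?C" by (rule gen_subset[OF C])
    moreover have "?A \<inter> I \<subseteq> J" "?B \<inter> I \<subseteq> J"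
      using x xy by (simp_all add: residual_def)
    then have "?C \<inter> I \<subseteq> J" using ideal_distrib[OF A B I J] by blast
    ultimately show ?thesis by (auto simp: residual_def)
  qed
  have dots: "(x \<cdot> y) \<cdot> y \<in> residual I J" "y \<cdot> x \<in> residual I J" "y \<cdot> (x \<cdot> y) \<in> residual I J"
    if x: "x \<in> residual I J" and "y \<in> X" for x y
  proof -
    have "ideal (gen x)" using x by (simp add: residual_def ideal_gen)
    then show "(x \<cdot> y) \<cdot> y \<in> residual I J" "y \<cdot> x \<in> residual I J" "y \<cdot> (x \<cdot> y) \<in> residual I J"
      using in_gen[of x] \<open>y \<in> X\<close>
      by (intro smaller[OF x]; simp add: ideal_dot_dot ideal_dot ideal_dot_dot')+
  qed
  \<comment> \<open>The unit generates the trivial ideal, which is contained in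
    \<open>J\<close>.\<close>
  have "ideal {\<e>}"
    by (auto simp: L_ideal_def unit_closed unit_dot dot_unit dot_self)
  then have "gen \<e> \<subseteq> {\<e>}" by (rule gen_subset) simp
  then have "\<e> \<in> residual I J"
    using ideal_unit[OF J] unit_closed by (auto simp: residual_def)
  with _ show ?thesis
    using mp dots by (rule idealI) (auto simp: residual_def)
qed

lemma subset_residual_iff:
  assumes "ideal C"
  shows "C \<subseteq> residual I J \<longleftrightarrow> C \<inter> I \<subseteq> J"
  using gen_subset[OF assms] ideal_subset[OF assms] in_gen unfolding residual_def by blast

section \<open>The frame of ideals\<close>

abbreviation ideals :: "'a set gorder" where
  "ideals \<equiv> L_ideals X (\<cdot>) \<e>"

lemma ideals_simps [simp]:
  "carrier ideals = {I. ideal I}" "I \<sqsubseteq>\<^bsub>ideals\<^esub> J \<longleftrightarrow> I \<subseteq> J" "I .=\<^bsub>ideals\<^esub> J \<longleftrightarrow> I = J"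
  by (simp_all add: L_ideals_def)

lemma complete_lattice_ideals: "complete_lattice ideals"
proof -
  interpret partial_order ideals
    by standard (auto simp: L_ideals_def)
  show ?thesis
  \<comment> \<open>A greatest element together with infima of nonempty families suffices.\<close>
  proof (rule complete_lattice_criterion1)
    show "\<exists>g. greatest ideals g (carrier ideals)"
      using ideal_carrier ideal_subset by (auto simp: greatest_def)
    fix \<I> assume "\<I> \<subseteq> carrier ideals" "\<I> \<noteq> {}"
    then have "greatest ideals (\<Inter>\<I>) (Lower ideals \<I>)"
      using ideal_Inter[of \<I>] by (auto simp: greatest_def Lower_def)
    then show "\<exists>i. greatest ideals i (Lower ideals \<I>)" ..
  qed
qed

lemma meet_ideals:
  assumes "ideal I" "ideal J"
  shows "I \<sqinter>\<^bsub>ideals\<^esub> J = I \<inter> J"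
proof -
  interpret complete_lattice ideals by (rule complete_lattice_ideals)
  have "ideal (I \<sqinter>\<^bsub>ideals\<^esub> J)" using meet_closed[of I J] assms by simp
  then show ?thesis
    using assms meet_left[of I J] meet_right[of I J] meet_le[of "I \<inter> J" I J]
    by (auto simp: ideal_Int)
qed

lemma top_ideals: "\<top>\<^bsub>ideals\<^esub> = X"
proof -
  interpret complete_lattice ideals by (rule complete_lattice_ideals)
  show ?thesis
    using top_higher[of X] top_closed ideal_carrier ideal_subset by auto
qed

lemma frame_lattice_ideals: "frame_lattice ideals"
proof -
  interpret complete_lattice ideals by (rule complete_lattice_ideals)
  show ?thesis
  proof
    fix I \<B> assume "I \<in> carrier ideals" and \<B>: "\<B> \<subseteq> carrier ideals"
    then have I: "ideal I" by simp
    have \<B>': "ideal B" if "B \<in> \<B>" for B using \<B> that by auto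
    let ?f = "\<lambda>B. I \<sqinter>\<^bsub>ideals\<^esub> B"
    have f: "?f ` \<B> \<subseteq> carrier ideals" using I \<B> by (auto simp: meet_ideals ideal_Int)
    let ?S = "\<Squnion>\<^bsub>ideals\<^esub>\<B>" and ?J = "\<Squnion>\<^bsub>ideals\<^esub>(?f ` \<B>)"
    have S: "ideal ?S" and J: "ideal ?J" using sup_closed[OF \<B>] sup_closed[OF f] by auto
    \<comment> \<open>Meeting with \<open>I\<close> has the right adjoint \<open>residual I\<close>,
      hence preserves suprema: each member lies below the ideal \<open>residual I ?J\<close>, and
      therefore so does their supremum.\<close>
    have "B \<subseteq> residual I ?J" if "B \<in> \<B>" for B
      using that I \<B>' sup_upper[OF f, of "?f B"] by (auto simp: subset_residual_iff meet_ideals)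
    then have "?S \<subseteq> residual I ?J"
      using sup_least[OF \<B>, of "residual I ?J"] ideal_residual[OF I J] by simp
    then have "I \<sqinter>\<^bsub>ideals\<^esub> ?S \<subseteq> ?J"
      using S I by (auto simp: subset_residual_iff meet_ideals)
    moreover have "?J \<subseteq> I \<sqinter>\<^bsub>ideals\<^esub> ?S"
      using sup_least[OF f, of "I \<inter> ?S"] sup_upper[OF \<B>] I S \<B>'
      by (force simp: meet_ideals ideal_Int)
    ultimately show "I \<sqinter>\<^bsub>ideals\<^esub> ?S = ?J" by auto
  qed
qed

text \<open>Both sides are ideals and contain the same ideals, by the adjunction with meeting
  \<open>I\<close>; taking each side as \<open>C\<close> gives equality.\<close>

lemma frame_imp_ideals:
  assumes I: "ideal I" and J: "ideal J"
  shows "frame_imp ideals I J = residual I J"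
proof -
  interpret frame_lattice ideals by (rule frame_lattice_ideals)
  have "C \<subseteq> frame_imp ideals I J \<longleftrightarrow> C \<subseteq> residual I J" if C: "ideal C" for C
    using le_frame_imp_iff[of I J C] I J C
    by (simp only: ideals_simps mem_Collect_eq meet_ideals subset_residual_iff)
  moreover have "ideal (frame_imp ideals I J)"
    using frame_imp_closed[of I J] by (simp only: ideals_simps mem_Collect_eq)
  ultimately show ?thesis
    using ideal_residual[OF I J] by blast
qed

section \<open>Prime ideals\<close>

text \<open>Only modus ponens involves two members of the chain, and the larger of them contains
  both premises. Nonemptiness provides the unit.\<close>

lemma ideal_chain_Union:
  assumes chain: "subset.chain {I. ideal I} \<C>" and "\<C> \<noteq> {}"
  shows "ideal (\<Union>\<C>)"
proof -
  have \<C>: "ideal C" if "C \<in> \<C>" for C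
    using chain that by (auto simp: subset.chain_def)
  have mp: "y \<in> \<Union>\<C>" if x: "x \<in> \<Union>\<C>" and xy: "x \<cdot> y \<in> \<Union>\<C>" and "y \<in> X" for x y
  proof -
    obtain C D where CD: "C \<in> \<C>" "D \<in> \<C>" "x \<in> C" "x \<cdot> y \<in> D" using x xy by blast
    then have "C \<subseteq> D \<or> D \<subseteq> C" using chain by (auto simp: subset_chain_def)
    then show ?thesis
      using CD \<C> ideal_mp[OF _ _ _ \<open>y \<in> X\<close>] by blast
  qed
  have dots: "(x \<cdot> y) \<cdot> y \<in> \<Union>\<C>" "y \<cdot> x \<in> \<Union>\<C>" "y \<cdot> (x \<cdot> y) \<in> \<Union>\<C>"
    if x: "x \<in> \<Union>\<C>" and y: "y \<in> X" for x y
  proof -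
    obtain C where C: "C \<in> \<C>" "x \<in> C" using x by blast
    note ideal = \<C>[OF C(1)]
    show "(x \<cdot> y) \<cdot> y \<in> \<Union>\<C>" "y \<cdot> x \<in> \<Union>\<C>" "y \<cdot> (x \<cdot> y) \<in> \<Union>\<C>"
      using C(1) ideal_dot_dot[OF ideal C(2) y] ideal_dot[OF ideal C(2) y]
        ideal_dot_dot'[OF ideal C(2) y] by blast+
  qed
  have "\<Union>\<C> \<subseteq> X" "\<e> \<in> \<Union>\<C>"
    using \<C> \<open>\<C> \<noteq> {}\<close> ideal_subset ideal_unit by blast+
  then show ?thesis
    using mp dots by (rule idealI)
qed

lemma ex_maximal_ideal_omitting:
  assumes "ideal I" "x \<notin> I"
  obtains M where "ideal M" "I \<subseteq> M" "x \<notin> M" "\<And>K. \<lbrakk>ideal K; M \<subset> K\<rbrakk> \<Longrightarrow> x \<in> K"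
proof -
  let ?S = "{K. ideal K \<and> I \<subseteq> K \<and> x \<notin> K}"
  have "\<exists>M\<in>?S. \<forall>K\<in>?S. M \<subseteq> K \<longrightarrow> K = M"
  proof (rule subset_Zorn_nonempty)
    show "?S \<noteq> {}" using assms by blast
    fix \<C> assume "\<C> \<noteq> {}" and chain: "subset.chain ?S \<C>"
    then have "subset.chain {K. ideal K} \<C>" and sub: "\<C> \<subseteq> ?S"
      by (auto simp: subset_chain_def)
    then have "ideal (\<Union>\<C>)"
      using \<open>\<C> \<noteq> {}\<close> by (intro ideal_chain_Union)
    moreover have "I \<subseteq> \<Union>\<C>" "x \<notin> \<Union>\<C>"
      using sub \<open>\<C> \<noteq> {}\<close> by blast+
    ultimately show "\<Union>\<C> \<in> ?S" by simp
  qed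
  then obtain M where M: "ideal M" "I \<subseteq> M" "x \<notin> M" and max: "\<forall>K\<in>?S. M \<subseteq> K \<longrightarrow> K = M"
    by blast
  have "x \<in> K" if "ideal K" "M \<subset> K" for K
    using max M(2) that by blast
  with M show thesis by (rule that)
qed

text \<open>Maximality is applied to two residuals above \<open>M\<close>. If primality fails,
  \<open>residual A M\<close> contains \<open>x\<close>, so \<open>A\<close> lies in
  \<open>residual (gen x) M\<close>. This ideal is then also strictly above \<open>M\<close> and
  contains \<open>x\<close>, which forces \<open>gen x\<close> into \<open>M\<close>.\<close>

lemma maximal_omitting_prime:
  assumes M: "ideal M" and x: "x \<in> X" "x \<notin> M" and max: "\<And>K. \<lbrakk>ideal K; M \<subset> K\<rbrakk> \<Longrightarrow> x \<in> K"
    and A: "ideal A"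
  shows "A \<subseteq> M \<or> residual A M \<subseteq> M"
proof (rule ccontr)
  assume not: "\<not> ?thesis"
  have M_sub: "M \<subseteq> residual B M" for B
    using M by (auto simp: subset_residual_iff)
  have "x \<in> residual A M"
    using not M_sub max ideal_residual[OF A M] by blast
  then have "A \<subseteq> residual (gen x) M"
    using subset_residual_iff[OF A] by (auto simp: residual_def)
  then have "x \<in> residual (gen x) M"
    using not M_sub max ideal_residual[OF ideal_gen[OF x(1)] M] by blast
  then show False using x in_gen[of x] by (auto simp: residual_def)
qed

section \<open>Spatiality of the frame of ideals\<close>

lemma L_order_ideals_le:
  assumes "ideal I" "ideal J"
  shows "I \<sqsubseteq>\<^bsub>L_order {K. ideal K} (frame_imp ideals) X\<^esub> J \<longleftrightarrow> I \<subseteq> J"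
proof -
  interpret frame_lattice ideals by (rule frame_lattice_ideals)
  show ?thesis
    using frame_imp_eq_top_iff[of I J] assms by (simp add: L_order_def top_ideals)
qed

lemma prime_ideals_iff:
  "P \<in> L_primes {K. ideal K} (frame_imp ideals) X \<longleftrightarrow>
    ideal P \<and> P \<noteq> X \<and> (\<forall>A. ideal A \<longrightarrow> A \<subseteq> P \<or> residual A P \<subseteq> P)"
proof -
  let ?L = "L_order {K. ideal K} (frame_imp ideals) X"
  have "P \<sqsubset>\<^bsub>?L\<^esub> X \<longleftrightarrow> P \<noteq> X" if P: "ideal P"
  proof -
    have "P \<sqsubset>\<^bsub>?L\<^esub> X \<longleftrightarrow> P \<sqsubseteq>\<^bsub>?L\<^esub> X \<and> P \<noteq> X"
      by (simp add: lless_def L_order_def)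
    then show ?thesis
      using P ideal_subset[OF P] by (simp add: L_order_ideals_le ideal_carrier)
  qed
  then show ?thesis
    by (cases "ideal P") (auto simp: L_primes_def L_order_ideals_le frame_imp_ideals ideal_residual)
qed

lemma spatial_L_algebra_ideals:
  "spatial_L_algebra {K. ideal K} (frame_imp ideals) X"
proof (intro spatial_L_algebra.intro spatial_L_algebra_axioms.intro)
  show "L_algebra {K. ideal K} (frame_imp ideals) X"
    using frame_lattice.L_algebra_frame_imp[OF frame_lattice_ideals] by (simp add: top_ideals)
next
  let ?L = "L_order {K. ideal K} (frame_imp ideals) X"
  let ?P = "L_primes {K. ideal K} (frame_imp ideals) X"
  have [simp]: "carrier ?L = {I. ideal I}" by (simp add: L_order_def)
  fix I assume "I \<in> {K. ideal K}"
  then have I: "ideal I" by simp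
  have prime_ideal: "ideal P" if "P \<in> ?P" for P
    using that prime_ideals_iff by blast
  \<comment> \<open>An element of \<open>D\<close> outside \<open>I\<close> would be omitted by some
    prime ideal above \<open>I\<close>. The argument includes I = X, where the family of primes is
    empty.\<close>
  have below: "D \<subseteq> I" if D: "ideal D" "\<And>P. \<lbrakk>P \<in> ?P; I \<subseteq> P\<rbrakk> \<Longrightarrow> D \<subseteq> P" for D
  proof
    fix x assume "x \<in> D"
    show "x \<in> I"
    proof (rule ccontr)
      assume "x \<notin> I"
      obtain M where M: "ideal M" "I \<subseteq> M" "x \<notin> M"
        and max: "\<And>K. \<lbrakk>ideal K; M \<subset> K\<rbrakk> \<Longrightarrow> x \<in> K"
        using ex_maximal_ideal_omitting[OF I \<open>x \<notin> I\<close>] by metis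
      \<comment> \<open>Membership of \<open>x\<close> in \<open>X\<close> also shows that
        \<open>M\<close> is proper, as primality requires.\<close>
      have "x \<in> X" using \<open>x \<in> D\<close> D(1) ideal_subset by blast
      with M max have "M \<in> ?P"
        using maximal_omitting_prime[of M x] by (auto simp: prime_ideals_iff)
      with M(2,3) D(2) \<open>x \<in> D\<close> show False by blast
    qed
  qed
  have "{P \<in> ?P. I \<sqsubseteq>\<^bsub>?L\<^esub> P} = {P \<in> ?P. I \<subseteq> P}"
    using L_order_ideals_le[OF I prime_ideal] by blast
  moreover have "Lower ?L {P \<in> ?P. I \<subseteq> P} = {D. ideal D \<and> (\<forall>P\<in>?P. I \<subseteq> P \<longrightarrow> D \<subseteq> P)}"
    using L_order_ideals_le prime_ideal by (auto simp: Lower_def)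
  ultimately show "is_glb ?L I {P \<in> ?P. I \<sqsubseteq>\<^bsub>?L\<^esub> P}"
    using I below by (auto simp: greatest_def L_order_ideals_le)
qed

end

theorem corollary5:
  fixes X :: "'a set" and dot :: "'a \<Rightarrow> 'a \<Rightarrow> 'a" and unit :: 'a
  assumes "L_algebra X dot unit"
  shows "spatial_frame (L_ideals X dot unit) \<and>
    (\<forall>I J. L_ideal X dot unit I \<and> L_ideal X dot unit J \<longrightarrow>
      frame_imp (L_ideals X dot unit) I J =
        {x \<in> X. L_genideal X dot unit x \<inter> I \<subseteq> J})"
proof -
  interpret L_algebra X dot unit by (rule assms)
  show ?thesis
    using frame_lattice_ideals spatial_L_algebra_ideals
    by (simp add: spatial_frame_def top_ideals frame_imp_ideals residual_def)
qed

end
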